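(* Let $X_{0},X_{1},E,F$ be non-trivial Banach spaces such that $X_{0},X_{1}\hookrightarrow E$, the spaces $X_{0}$ and $X_{0}\cap X_{1}$ have separable preduals, and $E$ is separable and reflexive. Suppose that $T:E\rightarrow F$ is a bounded linear operator satisfying the equality $$T(X_{0}\cap X_{1})=T(X_{1}).$$ Then, for any $\theta\in(0,1)$ and $q\in[1,\infty)$, we have $$T(X_{0}\cap X_{\theta,q})=T(X_{\theta,q}),$$ where $X_{\theta,q}:=(X_{0},X_{1})_{\theta,q}$.
   Context: $(X_0,X_1)_{\theta,q}$ denotes the usual real interpolation space (e.g. by the $K$-method), and $\hookrightarrow$ between spaces denotes continuous embedding. Embeddings of images: if $A,B,F$ are Banach spaces and $T_1:A\to F$, $T_2:B\to F$ are linear operators, one writes $T_2(B)\hookrightarrow T_1(A)$ if there exists a constant $C>0$ such that for any $b\in B$ there exists $a\in A$ with $T_1a=T_2b$ in $F$ and $\|a\|_A\le C\|b\|_B$. One writes $T_2(B)=T_1(A)$ when both $T_2(B)\hookrightarrow T_1(A)$ and $T_1(A)\hookrightarrow T_2(B)$ hold. Here $T$ is restricted to the respective subspaces of $E$, each with its own norm. *)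

theory Defs
  imports "HOL-Analysis.Analysis"
begin

text \<open>
  A space continuously embedded in \<open>E\<close> is represented by its image in \<open>E\<close> together
  with its own norm. The values of \<open>nrm\<close> outside \<open>carr\<close> are irrelevant.
\<close>

record 'e normed_sub =
  carr :: "'e set"
  nrm :: "'e \<Rightarrow> real"

definition is_normed :: "'e::real_vector normed_sub \<Rightarrow> bool" where
  "is_normed X \<longleftrightarrow>
     subspace (carr X) \<and>
     (\<forall>x\<in>carr X. 0 \<le> nrm X x) \<and>
     (\<forall>x\<in>carr X. nrm X x = 0 \<longleftrightarrow> x = 0) \<and>
     (\<forall>x\<in>carr X. \<forall>y\<in>carr X. nrm X (x + y) \<le> nrm X x + nrm X y) \<and>
     (\<forall>c. \<forall>x\<in>carr X. nrm X (c *\<^sub>R x) = \<bar>c\<bar> * nrm X x)"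

definition is_banach :: "'e::real_vector normed_sub \<Rightarrow> bool" where
  "is_banach X \<longleftrightarrow>
     is_normed X \<and>
     (\<forall>s. (\<forall>n. s n \<in> carr X) \<and>
          (\<forall>e>0. \<exists>M. \<forall>m\<ge>M. \<forall>n\<ge>M. nrm X (s m - s n) < e) \<longrightarrow>
          (\<exists>l\<in>carr X. (\<lambda>n::nat. nrm X (s n - l)) \<longlonglongrightarrow> 0))"

definition nontrivial :: "'e::real_vector normed_sub \<Rightarrow> bool" where
  "nontrivial X \<longleftrightarrow> (\<exists>x\<in>carr X. x \<noteq> 0)"

definition embedded :: "'e::real_normed_vector normed_sub \<Rightarrow> bool" where
  "embedded X \<longleftrightarrow> (\<exists>C>0. \<forall>x\<in>carr X. norm x \<le> C * nrm X x)"

definition intersection :: "'e normed_sub \<Rightarrow> 'e normed_sub \<Rightarrow> 'e normed_sub" where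
  "intersection X Y = \<lparr>carr = carr X \<inter> carr Y, nrm = (\<lambda>x. max (nrm X x) (nrm Y x))\<rparr>"

text \<open>
  \<open>has_separable_predual X TYPE('y)\<close>: the Banach space \<open>'y\<close> is separable and its dual is
  isomorphic, as a Banach space, to \<open>X\<close>. The isomorphism need not be isometric.
\<close>

definition has_separable_predual ::
  "'e::real_normed_vector normed_sub \<Rightarrow> 'y::banach itself \<Rightarrow> bool" where
  "has_separable_predual X (_ :: 'y itself) \<longleftrightarrow>
     separable_space (euclidean :: 'y topology) \<and>
     (\<exists>J :: ('y \<Rightarrow>\<^sub>L real) \<Rightarrow> 'e.
        linear J \<and> bij_betw J UNIV (carr X) \<and>
        (\<exists>C>0. \<forall>f. nrm X (J f) \<le> C * norm f \<and> norm f \<le> C * nrm X (J f)))"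

definition reflexive_space :: "'e::real_normed_vector itself \<Rightarrow> bool" where
  "reflexive_space (_ :: 'e itself) \<longleftrightarrow>
     (\<forall>\<phi> :: ('e \<Rightarrow>\<^sub>L real) \<Rightarrow>\<^sub>L real. \<exists>x. \<forall>f. blinfun_apply \<phi> f = blinfun_apply f x)"

definition K_functional ::
  "'e::real_vector normed_sub \<Rightarrow> 'e normed_sub \<Rightarrow> real \<Rightarrow> 'e \<Rightarrow> real" where
  "K_functional X0 X1 t x =
     Inf {nrm X0 x0 + t * nrm X1 x1 |x0 x1. x0 \<in> carr X0 \<and> x1 \<in> carr X1 \<and> x = x0 + x1}"

definition interp_integral ::
  "'e::real_vector normed_sub \<Rightarrow> 'e normed_sub \<Rightarrow> real \<Rightarrow> real \<Rightarrow> 'e \<Rightarrow> ennreal" where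
  "interp_integral X0 X1 \<theta> q x =
     (\<integral>\<^sup>+t\<in>{0<..}. ennreal ((t powr (-\<theta>) * K_functional X0 X1 t x) powr q / t) \<partial>lborel)"

definition real_interp ::
  "'e::real_vector normed_sub \<Rightarrow> 'e normed_sub \<Rightarrow> real \<Rightarrow> real \<Rightarrow> 'e normed_sub" where
  "real_interp X0 X1 \<theta> q =
     \<lparr>carr = {x0 + x1 |x0 x1. x0 \<in> carr X0 \<and> x1 \<in> carr X1 \<and>
                interp_integral X0 X1 \<theta> q (x0 + x1) < \<infinity>},
      nrm = (\<lambda>x. enn2real (interp_integral X0 X1 \<theta> q x) powr (1 / q))\<rparr>"

text \<open>\<open>image_embedded T2 B T1 A\<close> is \<open>T2(B) \<hookrightarrow> T1(A)\<close>.\<close>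

definition image_embedded ::
  "('b \<Rightarrow> 'f) \<Rightarrow> 'b normed_sub \<Rightarrow> ('a \<Rightarrow> 'f) \<Rightarrow> 'a normed_sub \<Rightarrow> bool" where
  "image_embedded T2 B T1 A \<longleftrightarrow>
     (\<exists>C>0. \<forall>b\<in>carr B. \<exists>a\<in>carr A. T1 a = T2 b \<and> nrm A a \<le> C * nrm B b)"

definition image_equal ::
  "('b \<Rightarrow> 'f) \<Rightarrow> 'b normed_sub \<Rightarrow> ('a \<Rightarrow> 'f) \<Rightarrow> 'a normed_sub \<Rightarrow> bool" where
  "image_equal T2 B T1 A \<longleftrightarrow> image_embedded T2 B T1 A \<and> image_embedded T1 A T2 B"

end

theory Submission
  imports Defs
begin

text \<open>
  Split \<open>b = x0 + x1\<close> almost optimally for \<open>K(1, b)\<close> and replace \<open>x1\<close> by some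
  \<open>a1 \<in> X0 \<inter> X1\<close> with the same image under \<open>T\<close>. Then \<open>a = x0 + a1\<close> lies in \<open>X0\<close> with norm
  at most a multiple of \<open>K(1, b)\<close>, which settles \<open>K(t, a)\<close> for \<open>t \<ge> 1\<close>. For \<open>t < 1\<close> one uses
  \<open>a = b + (a1 - x1)\<close>, where \<open>a1 - x1\<close> has \<open>X1\<close>-norm at most a multiple of \<open>K(1, b) \<le> K(t, b) / t\<close>.
  So \<open>K(t, a) \<le> D * K(t, b)\<close> for all \<open>t > 0\<close>, and interpolation norms compare accordingly.
\<close>

section \<open>Consequences of the norm axioms\<close>

lemma is_normedD:
  assumes "is_normed X"
  shows "0 \<in> carr X" and "nrm X 0 = 0"
    and "x \<in> carr X \<Longrightarrow> 0 \<le> nrm X x"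
    and "x \<in> carr X \<Longrightarrow> y \<in> carr X \<Longrightarrow> x + y \<in> carr X"
    and "x \<in> carr X \<Longrightarrow> y \<in> carr X \<Longrightarrow> x - y \<in> carr X"
    and "x \<in> carr X \<Longrightarrow> y \<in> carr X \<Longrightarrow> nrm X (x + y) \<le> nrm X x + nrm X y"
    and "x \<in> carr X \<Longrightarrow> y \<in> carr X \<Longrightarrow> nrm X (x - y) \<le> nrm X x + nrm X y"
proof -
  have sub: "subspace (carr X)" using assms by (simp add: is_normed_def)
  show zero: "0 \<in> carr X" using sub by (rule subspace_0)
  show "nrm X 0 = 0" using assms zero by (auto simp: is_normed_def)
  show "x \<in> carr X \<Longrightarrow> 0 \<le> nrm X x" using assms by (auto simp: is_normed_def)
  show "x \<in> carr X \<Longrightarrow> y \<in> carr X \<Longrightarrow> x + y \<in> carr X" using sub by (rule subspace_add)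
  show "x \<in> carr X \<Longrightarrow> y \<in> carr X \<Longrightarrow> x - y \<in> carr X" using sub by (rule subspace_diff)
  show tri: "nrm X (x + y) \<le> nrm X x + nrm X y" if "x \<in> carr X" "y \<in> carr X" for x y
    using assms that by (auto simp: is_normed_def)
  show "nrm X (x - y) \<le> nrm X x + nrm X y" if "x \<in> carr X" "y \<in> carr X"
  proof -
    have "nrm X ((-1) *\<^sub>R y) = \<bar>-1\<bar> * nrm X y" using assms that unfolding is_normed_def by blast
    moreover have "(-1) *\<^sub>R y \<in> carr X" using sub that(2) by (rule subspace_scale)
    ultimately show ?thesis using tri[of x "(-1) *\<^sub>R y"] that by simp
  qed
qed

section \<open>Estimates for the K-functional\<close>

lemma K_functional_le:
  assumes "is_normed X0" "is_normed X1" "0 \<le> t" "x0 \<in> carr X0" "x1 \<in> carr X1"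
  shows "K_functional X0 X1 t (x0 + x1) \<le> nrm X0 x0 + t * nrm X1 x1"
  unfolding K_functional_def
proof (rule cInf_lower)
  show "bdd_below {nrm X0 y0 + t * nrm X1 y1 |y0 y1.
      y0 \<in> carr X0 \<and> y1 \<in> carr X1 \<and> x0 + x1 = y0 + y1}"
    using assms by (intro bdd_belowI[of _ 0]) (auto simp: is_normedD(3))
qed (use assms in blast)

text \<open>The decomposition \<open>x = x0 + x1\<close> makes the set under \<open>Inf\<close>
  nonempty, without which a common lower bound says nothing about the infimum.\<close>

lemma le_K_functional:
  assumes "x0 \<in> carr X0" "x1 \<in> carr X1" "x = x0 + x1"
    and "\<And>y0 y1. y0 \<in> carr X0 \<Longrightarrow> y1 \<in> carr X1 \<Longrightarrow> x = y0 + y1 \<Longrightarrow> c \<le> nrm X0 y0 + t * nrm X1 y1"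
  shows "c \<le> K_functional X0 X1 t x"
  unfolding K_functional_def using assms by (intro cInf_greatest) blast+

lemma K_functional_nonneg:
  assumes "is_normed X0" "is_normed X1" "0 \<le> t" "x0 \<in> carr X0" "x1 \<in> carr X1"
  shows "0 \<le> K_functional X0 X1 t (x0 + x1)"
  using assms by (intro le_K_functional[of x0 _ x1]) (auto simp: is_normedD(3))

lemma K_functional_mono:
  assumes "is_normed X0" "is_normed X1" "0 \<le> s" "s \<le> t" "x0 \<in> carr X0" "x1 \<in> carr X1"
  shows "K_functional X0 X1 s (x0 + x1) \<le> K_functional X0 X1 t (x0 + x1)"
proof (rule le_K_functional[of x0 _ x1])
  fix y0 y1 assume y: "y0 \<in> carr X0" "y1 \<in> carr X1" "x0 + x1 = y0 + y1"
  have "s * nrm X1 y1 \<le> t * nrm X1 y1"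
    using assms y by (intro mult_right_mono is_normedD(3))
  then show "K_functional X0 X1 s (x0 + x1) \<le> nrm X0 y0 + t * nrm X1 y1"
    using K_functional_le[of X0 X1 s y0 y1] assms y by simp
qed (use assms in auto)

text \<open>For \<open>t \<le> 1\<close> each single decomposition already satisfies the estimate.
  This is the part of "K(t, x) / t is nonincreasing" that turns a bound by K(1, b) into one by K(t,
  b) for small t.\<close>

lemma K_functional_one_le:
  assumes "is_normed X0" "is_normed X1" "0 \<le> t" "t \<le> 1" "x0 \<in> carr X0" "x1 \<in> carr X1"
  shows "t * K_functional X0 X1 1 (x0 + x1) \<le> K_functional X0 X1 t (x0 + x1)"
proof (rule le_K_functional[of x0 _ x1])
  fix y0 y1 assume y: "y0 \<in> carr X0" "y1 \<in> carr X1" "x0 + x1 = y0 + y1"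
  have "t * K_functional X0 X1 1 (x0 + x1) \<le> t * (nrm X0 y0 + 1 * nrm X1 y1)"
    unfolding y(3) using assms y by (intro mult_left_mono K_functional_le) auto
  also have "\<dots> \<le> nrm X0 y0 + t * nrm X1 y1"
    using mult_right_mono[of t 1 "nrm X0 y0"] is_normedD(3)[of X0 y0] assms y
    by (simp add: algebra_simps)
  finally show "t * K_functional X0 X1 1 (x0 + x1) \<le> nrm X0 y0 + t * nrm X1 y1" .
qed (use assms in auto)

text \<open>The embeddings turn the triangle inequality in the ambient space into the lower bound
  \<open>norm (x0 + x1) / (A + B)\<close>, valid for every decomposition and hence for the
  infimum.\<close>

lemma K_functional_one_pos:
  assumes "is_normed X0" "is_normed X1" "embedded X0" "embedded X1"
    and "x0 \<in> carr X0" "x1 \<in> carr X1" "x0 + x1 \<noteq> 0"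
  shows "0 < K_functional X0 X1 1 (x0 + x1)"
proof -
  obtain A where A: "A > 0" "\<And>x. x \<in> carr X0 \<Longrightarrow> norm x \<le> A * nrm X0 x"
    using assms unfolding embedded_def by blast
  obtain B where B: "B > 0" "\<And>x. x \<in> carr X1 \<Longrightarrow> norm x \<le> B * nrm X1 x"
    using assms unfolding embedded_def by blast
  have "norm (x0 + x1) / (A + B) \<le> K_functional X0 X1 1 (x0 + x1)"
  proof (rule le_K_functional[of x0 _ x1])
    fix y0 y1 assume y: "y0 \<in> carr X0" "y1 \<in> carr X1" "x0 + x1 = y0 + y1"
    have "norm (x0 + x1) \<le> norm y0 + norm y1" using y by (simp add: norm_triangle_ineq)
    also have "\<dots> \<le> A * nrm X0 y0 + B * nrm X1 y1" using A(2) B(2) y by (simp add: add_mono)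
    also have "\<dots> \<le> (A + B) * nrm X0 y0 + (A + B) * nrm X1 y1"
      using A(1) B(1) assms y by (intro add_mono mult_right_mono is_normedD(3)) auto
    finally show "norm (x0 + x1) / (A + B) \<le> nrm X0 y0 + 1 * nrm X1 y1"
      using A(1) B(1) by (simp add: field_simps)
  qed (use assms in auto)
  moreover have "0 < norm (x0 + x1) / (A + B)" using A B assms by simp
  ultimately show ?thesis by linarith
qed

text \<open>If K(1, z) is positive, then twice it exceeds the infimum and cannot be a lower bound,
  so some decomposition beats it. At zero there is no such slack, but there \<open>0 + 0\<close>
  works.\<close>

lemma near_optimal_decomposition:
  assumes "is_normed X0" "is_normed X1" "embedded X0" "embedded X1"
    and "z0 \<in> carr X0" "z1 \<in> carr X1"
  obtains x0 x1 where "x0 \<in> carr X0" "x1 \<in> carr X1" "z0 + z1 = x0 + x1"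
    "nrm X0 x0 + nrm X1 x1 \<le> 2 * K_functional X0 X1 1 (z0 + z1)"
proof (cases "z0 + z1 = 0")
  case True
  then show ?thesis
    using that[of 0 0] is_normedD(1,2)[OF assms(1)] is_normedD(1,2)[OF assms(2)]
      K_functional_nonneg[of X0 X1 1 z0 z1] assms by simp
next
  case False
  let ?K = "K_functional X0 X1 1 (z0 + z1)"
  have "0 < ?K" using K_functional_one_pos assms False by blast
  then have "\<not> 2 * ?K \<le> ?K" by simp
  then have "\<exists>x0 x1. x0 \<in> carr X0 \<and> x1 \<in> carr X1 \<and> z0 + z1 = x0 + x1 \<and>
      \<not> 2 * ?K \<le> nrm X0 x0 + 1 * nrm X1 x1"
    using le_K_functional[OF assms(5,6) refl] by blast
  then obtain x0 x1 where "x0 \<in> carr X0" "x1 \<in> carr X1" "z0 + z1 = x0 + x1"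
      "\<not> 2 * ?K \<le> nrm X0 x0 + 1 * nrm X1 x1" by blast
  then show ?thesis using that[of x0 x1] by simp
qed

section \<open>Interpolation integrals\<close>

text \<open>Monotone functions are Borel. Truncating by \<open>max t 0\<close> gives a monotone
  function on the whole line, since monotonicity of K is available for nonnegative
  parameters.\<close>

lemma measurable_K_functional:
  assumes "is_normed X0" "is_normed X1" "x0 \<in> carr X0" "x1 \<in> carr X1"
  shows "(\<lambda>t. K_functional X0 X1 (max t 0) (x0 + x1)) \<in> borel_measurable borel"
  using assms by (intro borel_measurable_mono monoI K_functional_mono) auto

lemma interp_integral_mono:
  assumes X: "is_normed X0" "is_normed X1"
    and a: "a0 \<in> carr X0" "a1 \<in> carr X1" and b: "b0 \<in> carr X0" "b1 \<in> carr X1"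
    and "0 \<le> D" "0 < q"
    and le: "\<And>t. t > 0 \<Longrightarrow> K_functional X0 X1 t (a0 + a1) \<le> D * K_functional X0 X1 t (b0 + b1)"
  shows "interp_integral X0 X1 \<theta> q (a0 + a1)
    \<le> ennreal (D powr q) * interp_integral X0 X1 \<theta> q (b0 + b1)"
proof -
  \<comment> \<open>This is the integrand of the right-hand side, written with
    \<open>max t 0\<close> to be measurable; on \<open>{0<..}\<close> nothing changes. Measurability
    is what allows the factor \<open>D powr q\<close> to be pulled out of the integral.\<close>
  define g where "g t = ennreal ((t powr (-\<theta>) * K_functional X0 X1 (max t 0) (b0 + b1)) powr q / t)
    * indicator {0<..} t" for t :: real
  note [measurable] = measurable_K_functional[OF X b]
  have [measurable]: "g \<in> borel_measurable lborel" unfolding g_def by measurable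
  have "interp_integral X0 X1 \<theta> q (a0 + a1) \<le> (\<integral>\<^sup>+t. ennreal (D powr q) * g t \<partial>lborel)"
    unfolding interp_integral_def
  proof (rule nn_integral_mono)
    fix t :: real
    show "ennreal ((t powr (-\<theta>) * K_functional X0 X1 t (a0 + a1)) powr q / t) * indicator {0<..} t
        \<le> ennreal (D powr q) * g t"
    proof (cases "t > 0")
      case True
      have nn: "0 \<le> K_functional X0 X1 t (a0 + a1)" "0 \<le> K_functional X0 X1 t (b0 + b1)"
        using K_functional_nonneg[OF X _ a, of t] K_functional_nonneg[OF X _ b, of t] True by auto
      have "(t powr (-\<theta>) * K_functional X0 X1 t (a0 + a1)) powr q
          \<le> (t powr (-\<theta>) * (D * K_functional X0 X1 t (b0 + b1))) powr q"
        using nn \<open>0 < q\<close> le[OF True] by (intro powr_mono2 mult_left_mono mult_nonneg_nonneg) auto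
      also have "\<dots> = D powr q * (t powr (-\<theta>) * K_functional X0 X1 t (b0 + b1)) powr q"
        using nn \<open>0 \<le> D\<close> by (simp add: powr_mult mult_ac)
      finally show ?thesis
        using True unfolding g_def
        by (auto simp: ennreal_mult[symmetric] divide_right_mono intro!: ennreal_leI)
    qed simp
  qed
  also have "\<dots> = ennreal (D powr q) * (\<integral>\<^sup>+t. g t \<partial>lborel)"
    by (rule nn_integral_cmult) measurable
  also have "(\<integral>\<^sup>+t. g t \<partial>lborel) = interp_integral X0 X1 \<theta> q (b0 + b1)"
    unfolding interp_integral_def g_def
    by (intro nn_integral_cong) (auto simp: max_def split: split_indicator)
  finally show ?thesis .
qed

text \<open>Since K(t, x) increases in t, K(1, x) controls the integrand from below on [1, 2], an
  interval of length 1.\<close>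

lemma K_functional_one_le_interp_norm:
  assumes X: "is_normed X0" "is_normed X1" and x: "x0 \<in> carr X0" "x1 \<in> carr X1"
    and "0 \<le> \<theta>" "0 < q" and fin: "interp_integral X0 X1 \<theta> q (x0 + x1) < \<infinity>"
  shows "K_functional X0 X1 1 (x0 + x1)
    \<le> 2 powr (\<theta> + 1 / q) * nrm (real_interp X0 X1 \<theta> q) (x0 + x1)"
proof -
  let ?K = "\<lambda>t. K_functional X0 X1 t (x0 + x1)"
  \<comment> \<open>On [1, 2] one has \<open>2 powr (-\<theta>) \<le> t powr (-\<theta>)\<close>,
    K(1, x) \<le> K(t, x) and 1/2 \<le> 1/t, so c lies below the integrand there.\<close>
  define c where "c = (2 powr (-\<theta>) * ?K 1) powr q / 2"
  have K1: "0 \<le> ?K 1" using K_functional_nonneg[OF X _ x] by simp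
  have "ennreal c = (\<integral>\<^sup>+t. ennreal c * indicator {1..2::real} t \<partial>lborel)"
    by (simp add: nn_integral_cmult_indicator)
  also have "\<dots> \<le> interp_integral X0 X1 \<theta> q (x0 + x1)"
    unfolding interp_integral_def
  proof (rule nn_integral_mono)
    fix t :: real
    show "ennreal c * indicator {1..2} t
        \<le> ennreal ((t powr (-\<theta>) * ?K t) powr q / t) * indicator {0<..} t"
    proof (cases "1 \<le> t \<and> t \<le> 2")
      case True
      have "2 powr (-\<theta>) \<le> t powr (-\<theta>)" using True \<open>0 \<le> \<theta>\<close> by (intro powr_mono2') auto
      moreover have "?K 1 \<le> ?K t" using K_functional_mono[OF X _ _ x] True by simp
      ultimately have "2 powr (-\<theta>) * ?K 1 \<le> t powr (-\<theta>) * ?K t"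
        using K1 by (intro mult_mono) auto
      then have "(2 powr (-\<theta>) * ?K 1) powr q \<le> (t powr (-\<theta>) * ?K t) powr q"
        using K1 \<open>0 < q\<close> by (intro powr_mono2) auto
      then have "c \<le> (t powr (-\<theta>) * ?K t) powr q / t"
        unfolding c_def using True by (intro frac_le) auto
      then show ?thesis using True by (simp add: ennreal_leI)
    qed (auto split: split_indicator)
  qed
  finally have "c \<le> enn2real (interp_integral X0 X1 \<theta> q (x0 + x1))"
    using fin enn2real_mono[of "ennreal c"] by (simp add: c_def)
  then have "c powr (1 / q) \<le> nrm (real_interp X0 X1 \<theta> q) (x0 + x1)"
    using \<open>0 < q\<close> by (auto simp: real_interp_def c_def intro!: powr_mono2)
  moreover have "c powr (1 / q) = 2 powr (-\<theta>) * ?K 1 * 2 powr (- (1 / q))"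
    unfolding c_def using K1 \<open>0 < q\<close> by (simp add: powr_divide powr_powr powr_minus_divide powr_mult)
  then have "?K 1 = 2 powr (\<theta> + 1 / q) * c powr (1 / q)"
    by (simp add: powr_add powr_minus field_simps)
  ultimately show ?thesis by simp
qed

section \<open>Transfer of the images under T\<close>

theorem theorem4:
  fixes X0 X1 :: "'e::banach normed_sub"
    and T :: "'e \<Rightarrow> 'f::banach"
    and \<theta> q :: real
  assumes "is_banach X0" and "is_banach X1"
    and "nontrivial X0" and "nontrivial X1"
    and "\<exists>x::'e. x \<noteq> 0" and "\<exists>y::'f. y \<noteq> 0"
    and "embedded X0" and "embedded X1"
    and "has_separable_predual X0 TYPE('y::banach)"
    and "has_separable_predual (intersection X0 X1) TYPE('z::banach)"
    and "separable_space (euclidean :: 'e topology)"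
    and "reflexive_space TYPE('e)"
    and "bounded_linear T"
    and "image_equal T (intersection X0 X1) T X1"
    and "0 < \<theta>" and "\<theta> < 1" and "1 \<le> q"
  shows "image_equal T (intersection X0 (real_interp X0 X1 \<theta> q)) T (real_interp X0 X1 \<theta> q)"
proof -
  have X: "is_normed X0" "is_normed X1" using assms by (auto simp: is_banach_def)
  have T: "T (x + y) = T x + T y" for x y
    using \<open>bounded_linear T\<close> by (simp add: bounded_linear.linear linear_add)
  let ?I = "real_interp X0 X1 \<theta> q"
  let ?K = "K_functional X0 X1"
  obtain C where "C > 0" and
    C: "\<And>b. b \<in> carr X1 \<Longrightarrow> \<exists>a\<in>carr X0 \<inter> carr X1. T a = T b \<and> max (nrm X0 a) (nrm X1 a) \<le> C * nrm X1 b"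
    using \<open>image_equal T (intersection X0 X1) T X1\<close>
    unfolding image_equal_def image_embedded_def intersection_def by auto
  \<comment> \<open>D is 1 + 2(1 + C): the 1 pays for K(t, b) itself, and 2(1 + C) for the
    correction \<open>a1 - x1\<close>, the 2 coming from the near-optimal decomposition.\<close>
  define D where "D = 3 + 2 * C"
  \<comment> \<open>The intersection norm is a maximum: D serves the interpolation norm, the other
    entry the X0-norm.\<close>
  define M where "M = max D (D * 2 powr (\<theta> + 1 / q))"
  have "D > 0" using \<open>C > 0\<close> by (simp add: D_def)
  have "\<exists>a\<in>carr (intersection X0 ?I). T a = T b \<and> nrm (intersection X0 ?I) a \<le> M * nrm ?I b"
    if "b \<in> carr ?I" for b
  proof -
    obtain z0 z1 where z: "z0 \<in> carr X0" "z1 \<in> carr X1" "b = z0 + z1"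
      and fin: "interp_integral X0 X1 \<theta> q b < \<infinity>"
      using \<open>b \<in> carr ?I\<close> unfolding real_interp_def by auto
    obtain x0 x1 where x: "x0 \<in> carr X0" "x1 \<in> carr X1" "b = x0 + x1"
      and opt: "nrm X0 x0 + nrm X1 x1 \<le> 2 * ?K 1 b"
      using near_optimal_decomposition[OF X \<open>embedded X0\<close> \<open>embedded X1\<close> z(1,2)] z(3) by metis
    obtain a1 where a1: "a1 \<in> carr X0" "a1 \<in> carr X1" "T a1 = T x1"
      and a1_le: "nrm X0 a1 \<le> C * nrm X1 x1" "nrm X1 a1 \<le> C * nrm X1 x1"
      using C[OF x(2)] by auto
    define a where "a = x0 + a1"
    have aX0: "a \<in> carr X0" using X x a1 by (simp add: a_def is_normedD(4))
    \<comment> \<open>The left side dominates both the X0-estimate of \<open>x0 + a1\<close> and the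
      X1-norms of \<open>x1\<close> and \<open>a1\<close> together.\<close>
    have bound: "nrm X0 x0 + nrm X1 x1 + C * nrm X1 x1 \<le> 2 * (1 + C) * ?K 1 b"
    proof -
      have "(1 + C) * (nrm X0 x0 + nrm X1 x1) \<le> (1 + C) * (2 * ?K 1 b)"
        using opt \<open>C > 0\<close> by (intro mult_left_mono) auto
      moreover have "0 \<le> C * nrm X0 x0" using \<open>C > 0\<close> is_normedD(3)[OF X(1) x(1)] by simp
      ultimately show ?thesis by (simp add: algebra_simps)
    qed
    have K1: "0 \<le> ?K 1 b" using K_functional_nonneg[OF X _ x(1,2)] x(3) by simp
    have "nrm X0 a \<le> nrm X0 x0 + nrm X0 a1"
      unfolding a_def using is_normedD(6)[OF X(1)] x a1 by blast
    then have a_le': "nrm X0 a \<le> 2 * (1 + C) * ?K 1 b"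
      using a1_le bound is_normedD(3)[OF X(2) x(2)] by linarith
    then have a_le: "nrm X0 a \<le> D * ?K 1 b"
      using K1 unfolding D_def by (simp add: algebra_simps)
    \<comment> \<open>The summand 0 exhibits \<open>a\<close> as a sum over X0 and X1, the form that
      \<open>interp_integral_mono\<close> expects.\<close>
    have K_le: "?K t (a + 0) \<le> D * ?K t (x0 + x1)" if "t > 0" for t
    proof (cases "t \<le> 1")
      case True
      \<comment> \<open>Every decomposition \<open>b = y0 + y1\<close> yields
        \<open>a = y0 + (y1 - x1 + a1)\<close>. Moving the correction term to the left gives a lower
        bound for all of them at once.\<close>
      have "?K t a - t * (nrm X1 x1 + nrm X1 a1) \<le> ?K t b"
      proof (rule le_K_functional[OF x])
        fix y0 y1 assume y: "y0 \<in> carr X0" "y1 \<in> carr X1" "b = y0 + y1"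
        have mem: "y1 - x1 + a1 \<in> carr X1" using X(2) y x a1 by (simp add: is_normedD(4,5))
        have "a = y0 + (y1 - x1 + a1)"
          using x(3) y(3) unfolding a_def by (simp add: algebra_simps)
        then have "?K t a \<le> nrm X0 y0 + t * nrm X1 (y1 - x1 + a1)"
          using K_functional_le[OF X _ y(1) mem, of t] \<open>t > 0\<close> by simp
        also have "nrm X1 (y1 - x1 + a1) \<le> nrm X1 y1 + nrm X1 x1 + nrm X1 a1"
          using is_normedD(6)[OF X(2) is_normedD(5)[OF X(2) y(2) x(2)] a1(2)]
            is_normedD(7)[OF X(2) y(2) x(2)] by linarith
        finally show "?K t a - t * (nrm X1 x1 + nrm X1 a1) \<le> nrm X0 y0 + t * nrm X1 y1"
          using \<open>t > 0\<close> by (simp add: algebra_simps)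
      qed
      moreover have "nrm X1 x1 + nrm X1 a1 \<le> 2 * (1 + C) * ?K 1 b"
        using bound a1_le is_normedD(3)[OF X(1) x(1)] by linarith
      then have "t * (nrm X1 x1 + nrm X1 a1) \<le> 2 * (1 + C) * (t * ?K 1 b)"
        using mult_left_mono[of _ _ t] \<open>t > 0\<close> by (fastforce simp: mult_ac)
      moreover have "t * ?K 1 b \<le> ?K t b"
        using K_functional_one_le[OF X _ True x(1,2)] \<open>t > 0\<close> x(3) by simp
      then have "2 * (1 + C) * (t * ?K 1 b) \<le> 2 * (1 + C) * ?K t b"
        using \<open>C > 0\<close> by (intro mult_left_mono) auto
      ultimately show ?thesis using x(3) unfolding D_def by (simp add: algebra_simps)
    next
      case False
      \<comment> \<open>For t > 1 all of \<open>a\<close> is put into X0, and K(1, b) \<le> K(t,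
        b).\<close>
      have "?K t (a + 0) \<le> nrm X0 a"
        using K_functional_le[OF X _ aX0 is_normedD(1)[OF X(2)], of t] \<open>t > 0\<close> is_normedD(2)[OF X(2)]
        by simp
      also note a_le
      also have "D * ?K 1 b \<le> D * ?K t b"
        using K_functional_mono[OF X _ _ x(1,2), of 1 t] False x(3) \<open>D > 0\<close>
        by (intro mult_left_mono) auto
      finally show ?thesis using x(3) by simp
    qed
    have int_le: "interp_integral X0 X1 \<theta> q a \<le> ennreal (D powr q) * interp_integral X0 X1 \<theta> q b"
      using interp_integral_mono[OF X aX0 is_normedD(1)[OF X(2)] x(1,2) _ _ K_le] \<open>D > 0\<close> \<open>1 \<le> q\<close> x(3)
      by simp
    \<comment> \<open>Finiteness puts \<open>a\<close> into the interpolation space and makes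
      \<open>enn2real\<close> monotone here; it would send an infinite right-hand side to 0.\<close>
    have prod_fin: "ennreal (D powr q) * interp_integral X0 X1 \<theta> q b < \<infinity>"
      using fin by (simp add: ennreal_mult_less_top)
    with int_le have a_fin: "interp_integral X0 X1 \<theta> q a < \<infinity>" by (rule le_less_trans)
    have aI: "a \<in> carr ?I"
      unfolding real_interp_def using aX0 is_normedD(1)[OF X(2)] a_fin
      by simp (metis add.right_neutral)
    have nb: "0 \<le> nrm ?I b" by (simp add: real_interp_def)
    have "enn2real (interp_integral X0 X1 \<theta> q a) \<le> D powr q * enn2real (interp_integral X0 X1 \<theta> q b)"
      using enn2real_mono[OF int_le] prod_fin by (simp add: enn2real_mult)
    then have "nrm ?I a \<le> (D powr q * enn2real (interp_integral X0 X1 \<theta> q b)) powr (1 / q)"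
      using \<open>1 \<le> q\<close> by (auto simp: real_interp_def intro!: powr_mono2)
    also have "\<dots> = D * nrm ?I b"
      using \<open>D > 0\<close> \<open>1 \<le> q\<close> by (simp add: real_interp_def powr_mult powr_powr)
    finally have "nrm ?I a \<le> M * nrm ?I b"
      using mult_right_mono[OF _ nb, of D M] by (simp add: M_def)
    moreover have "nrm X0 a \<le> M * nrm ?I b"
    proof -
      have "?K 1 b \<le> 2 powr (\<theta> + 1 / q) * nrm ?I b"
        using K_functional_one_le_interp_norm[OF X x(1,2), of \<theta> q] fin x(3) \<open>0 < \<theta>\<close> \<open>1 \<le> q\<close> by simp
      then have "D * ?K 1 b \<le> D * 2 powr (\<theta> + 1 / q) * nrm ?I b"
        using \<open>D > 0\<close> by simp
      also have "\<dots> \<le> M * nrm ?I b"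
        using nb by (intro mult_right_mono) (auto simp: M_def)
      finally show ?thesis using a_le by linarith
    qed
    moreover have "T a = T b" using a1 x(3) by (simp add: a_def T)
    ultimately show ?thesis using aX0 aI by (intro bexI[of _ a]) (auto simp: intersection_def)
  qed
  moreover have "M > 0" using \<open>D > 0\<close> by (simp add: M_def)
  ultimately have "image_embedded T ?I T (intersection X0 ?I)"
    unfolding image_embedded_def by blast
  \<comment> \<open>For the converse each element is its own preimage, and the constant 1 suffices
    because the interpolation norm is at most the maximum.\<close>
  moreover have "image_embedded T (intersection X0 ?I) T ?I"
    unfolding image_embedded_def intersection_def by (intro exI[of _ 1]) auto
  ultimately show ?thesis unfolding image_equal_def by blast
qed

end
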